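(* Let $d\geq 2$ be a fixed integer and, for each $n>d$ such that $nd$ is even, let $G_n$ be a random graph chosen uniformly among all connected $d$-regular simple graphs on the vertex set $\{1,\dots,n\}$. Then $$\lim_{n\to\infty}\mathbb{P}(G_n\text{ admits an avoidance coupling of two walkers})=1,$$ where the limit is taken along those $n$ for which $nd$ is even.
   Context: For a finite simple graph $G=(V,E)$ and $v\in V$, write $N(v)=\{u\in V:\{u,v\}\in E\}$ and $\deg(v)=|N(v)|$. A (discrete-time) simple random walk on $G$ is a $V$-valued Markov chain $(X_t)_{t\geq 0}$ (with arbitrary initial law) such that $\mathbb{P}(X_{t+1}=u\mid X_t=v)=1/\deg(v)$ if $u\in N(v)$ and $0$ otherwise. An avoidance coupling (of two walkers) on $G$ is a discrete-time $(V\times V)$-valued process $(A_t,B_t)_{t\geq 0}$ such that: (1) (faithfulness) $(A_t)_{t\geq 0}$ and $(B_t)_{t\geq 0}$ are each simple random walks on $G$, each with respect to its own history; and (2) (avoidance) $B_t\notin\{A_t,A_{t+1}\}$ for all $t\geq 0$. A graph admits an avoidance coupling if such a process exists. *)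

theory Defs
  imports
    "HOL-Probability.Probability"
    "Graph_Theory.Pair_Digraph"
    "Graph_Theory.Digraph_Component"
begin

text \<open>
  A finite simple graph is a Graph_Theory \<open>pair_graph\<close>: a finite vertex set together with a
  symmetric, loop-free set of vertex pairs, the edge \<open>{u, v}\<close> being represented by the two
  pairs \<open>(u, v)\<close> and \<open>(v, u)\<close>. A graph on a given vertex set is thus determined by its edge set.
\<close>

definition nbhd :: "'v pair_pre_digraph \<Rightarrow> 'v \<Rightarrow> 'v set" where
  "nbhd G v = {u \<in> pverts G. (v, u) \<in> parcs G}"

definition deg :: "'v pair_pre_digraph \<Rightarrow> 'v \<Rightarrow> nat" where
  "deg G v = card (nbhd G v)"

definition connected_regular_graphs :: "nat \<Rightarrow> nat \<Rightarrow> nat pair_pre_digraph set" where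
  "connected_regular_graphs d n =
     {G. pair_graph G \<and> pverts G = {1..n} \<and> Digraph_Component.connected (with_proj G) \<and>
         (\<forall>v\<in>pverts G. deg G v = d)}"

text \<open>
  The process \<open>X\<close> is a Markov chain with respect to its own history: the transition law is
  required conditionally on every history \<open>X\<^sub>0 = x\<^sub>0, \<dots>, X\<^sub>t = x\<^sub>t\<close> of positive probability.
  Nothing is required of histories of probability zero, where \<open>cond_prob\<close> is \<open>0 / 0 = 0\<close>.
\<close>

definition simple_random_walk ::
    "'v pair_pre_digraph \<Rightarrow> 'a measure \<Rightarrow> (nat \<Rightarrow> 'a \<Rightarrow> 'v) \<Rightarrow> bool" where
  "simple_random_walk G M X \<longleftrightarrow>
     prob_space M \<and>
     (\<forall>t. X t \<in> measurable M (count_space (pverts G))) \<and>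
     (\<forall>t x u. u \<in> pverts G \<longrightarrow> \<P>(\<omega> in M. \<forall>i\<le>t. X i \<omega> = x i) > 0 \<longrightarrow>
        \<P>(\<omega> in M. X (Suc t) \<omega> = u \<bar> \<forall>i\<le>t. X i \<omega> = x i) =
          (if u \<in> nbhd G (x t) then 1 / real (deg G (x t)) else 0))"

definition avoidance_coupling ::
    "'v pair_pre_digraph \<Rightarrow> 'a measure \<Rightarrow> (nat \<Rightarrow> 'a \<Rightarrow> 'v) \<Rightarrow> (nat \<Rightarrow> 'a \<Rightarrow> 'v) \<Rightarrow> bool" where
  "avoidance_coupling G M A B \<longleftrightarrow>
     simple_random_walk G M A \<and> simple_random_walk G M B \<and>
     (\<forall>\<omega>\<in>space M. \<forall>t. B t \<omega> \<notin> {A t \<omega>, A (Suc t) \<omega>})"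

text \<open>
  HOL cannot quantify existentially over the type of the sample space, so sample points are taken
  to be trajectories of the pair of walkers. The sigma-algebra, the measure and the processes
  \<open>A\<close> and \<open>B\<close> remain arbitrary. By \<open>avoidance_coupling_imp_admits\<close> below, this loses nothing.
\<close>

definition admits_avoidance_coupling :: "'v pair_pre_digraph \<Rightarrow> bool" where
  "admits_avoidance_coupling G \<longleftrightarrow>
     (\<exists>(M :: (nat \<Rightarrow> 'v \<times> 'v) measure) A B. avoidance_coupling G M A B)"

lemma simple_random_walk_distr:
  assumes X: "simple_random_walk G M (\<lambda>t \<omega>. Y t (f \<omega>))"
    and f: "f \<in> measurable M N"
    and Y: "\<And>t. Y t \<in> measurable N (count_space (pverts G))"
  shows "simple_random_walk G (distr M N f) Y"
proof -
  interpret prob_space M using X by (simp add: simple_random_walk_def)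
  have sing: "{\<omega> \<in> space N. Y t \<omega> = v} \<in> sets N" for t v
  proof (cases "v \<in> pverts G")
    case True
    have "{\<omega> \<in> space N. Y t \<omega> = v} = Y t -` {v} \<inter> space N" by auto
    with measurable_sets[OF Y[of t], of "{v}"] True show ?thesis by simp
  next
    case False
    then have "{\<omega> \<in> space N. Y t \<omega> = v} = {}"
      using measurable_space[OF Y[of t]] by auto
    then show ?thesis by (metis sets.empty_sets)
  qed
  have hist: "{\<omega> \<in> space N. \<forall>i\<le>t. Y i \<omega> = x i} \<in> sets N" for t x
  proof -
    have "{\<omega> \<in> space N. \<forall>i\<in>{..t}. Y i \<omega> = x i} \<in> sets N"
      by (rule sets.sets_Collect_finite_All) (simp_all add: sing)
    then show ?thesis unfolding Ball_def atMost_iff .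
  qed
  have both: "{\<omega> \<in> space N. Y s \<omega> = u \<and> (\<forall>i\<le>t. Y i \<omega> = x i)} \<in> sets N" for s u t x
    by (rule sets.sets_Collect_conj[OF hist sing])
  have pr: "measure (distr M N f) {\<omega> \<in> space N. P \<omega>} =
      measure M {\<omega> \<in> space M. P (f \<omega>)}" if "{\<omega> \<in> space N. P \<omega>} \<in> sets N" for P
  proof -
    have "f -` {\<omega> \<in> space N. P \<omega>} \<inter> space M = {\<omega> \<in> space M. P (f \<omega>)}"
      using measurable_space[OF f] by auto
    with measure_distr[OF f that] show ?thesis by simp
  qed
  show ?thesis
    unfolding simple_random_walk_def cond_prob_def space_distr pr[OF hist] pr[OF both]
  proof (intro conjI allI impI)
    show "prob_space (distr M N f)" by (rule prob_space_distr[OF f])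
    show "Y t \<in> measurable (distr M N f) (count_space (pverts G))" for t
      using Y[of t] unfolding measurable_distr_eq1 .
  qed (use X in \<open>unfold simple_random_walk_def cond_prob_def, blast\<close>)
qed

lemma avoidance_coupling_imp_admits:
  fixes G :: "'v pair_pre_digraph" and M :: "'a measure"
  assumes "avoidance_coupling G M A B"
  shows "admits_avoidance_coupling G"
proof -
  define V where "V = count_space (pverts G)"
  define f where "f \<omega> t = (A t \<omega>, B t \<omega>)" for \<omega> t
  define N where "N = restrict_space (PiM UNIV (\<lambda>_. V \<Otimes>\<^sub>M V)) (f ` space M)"
  define A' where "A' t p = fst (p t)" for t and p :: "nat \<Rightarrow> 'v \<times> 'v"
  define B' where "B' t p = snd (p t)" for t and p :: "nat \<Rightarrow> 'v \<times> 'v"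
  have A [measurable]: "A t \<in> measurable M V" and B [measurable]: "B t \<in> measurable M V" for t
    using assms by (auto simp: avoidance_coupling_def simple_random_walk_def V_def)
  have f0: "f \<in> measurable M (PiM UNIV (\<lambda>_. V \<Otimes>\<^sub>M V))"
    unfolding f_def
  proof (rule measurable_PiM_single')
    show "(\<lambda>\<omega>. (A t \<omega>, B t \<omega>)) \<in> measurable M (V \<Otimes>\<^sub>M V)" for t
      by (rule measurable_Pair[OF A B])
    show "(\<lambda>\<omega> t. (A t \<omega>, B t \<omega>)) \<in> space M \<rightarrow> (\<Pi>\<^sub>E t\<in>UNIV. space (V \<Otimes>\<^sub>M V))"
      using measurable_space[OF A] measurable_space[OF B]
      by (auto simp: PiE_UNIV_domain space_pair_measure)
  qed
  then have f: "f \<in> measurable M N"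
    unfolding N_def by (intro measurable_restrict_space2) auto
  have sp: "space N = f ` space M"
    using measurable_space[OF f0] by (auto simp: N_def space_restrict_space)
  have A': "A' t \<in> measurable N V" and B': "B' t \<in> measurable N V" for t
    unfolding N_def A'_def B'_def by (intro measurable_restrict_space1; measurable)+
  have "simple_random_walk G (distr M N f) A'" "simple_random_walk G (distr M N f) B'"
    using assms A' B'
    by (auto intro!: simple_random_walk_distr[OF _ f]
        simp: avoidance_coupling_def A'_def B'_def f_def V_def)
  then have "avoidance_coupling G (distr M N f) A' B'"
    using assms by (auto simp: avoidance_coupling_def sp A'_def B'_def f_def)
  then show ?thesis by (auto simp: admits_avoidance_coupling_def)
qed

lemma finite_connected_regular_graphs: "finite (connected_regular_graphs d n)"
proof (rule finite_subset)
  let ?mk = "\<lambda>E. \<lparr>pverts = {1..n}, parcs = E\<rparr>"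
  show "connected_regular_graphs d n \<subseteq> ?mk ` Pow ({1..n} \<times> {1..n})"
  proof
    fix G assume "G \<in> connected_regular_graphs d n"
    then have G: "pair_graph G" "pverts G = {1..n}"
      by (auto simp: connected_regular_graphs_def)
    interpret pair_graph G by fact
    have "parcs G \<subseteq> {1..n} \<times> {1..n}"
      using arc_fst_in_verts arc_snd_in_verts G(2) by auto
    moreover have "G = ?mk (parcs G)" using G(2) by (cases G) simp
    ultimately show "G \<in> ?mk ` Pow ({1..n} \<times> {1..n})" by blast
  qed
qed simp

end

theory Submission
  imports Defs "HOL-Real_Asymp.Real_Asymp"
begin

text \<open>
  Keep the walkers at distinct, non-adjacent vertices \<open>a\<close>, \<open>b\<close>: moving \<open>A\<close> along a uniform edge and
  \<open>B\<close> along its image under a bijection \<open>\<sigma>\<close> from the neighbours of \<open>a\<close> to those of \<open>b\<close> is an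
  avoidance coupling, provided \<open>x\<close> and \<open>\<sigma> x\<close> are always distinct and non-adjacent. As neither a row
  nor a column of the relation ``equal or adjacent'' between the two neighbourhoods is full, such a
  \<open>\<sigma>\<close> exists unless the relation contains a \<open>2 \<times> 2\<close> rectangle, and a rectangle forces a
  \<open>K\<^sub>2\<^sub>,\<^sub>3\<close> or a diamond (\<open>K\<^sub>4\<close> minus an edge) in the graph. Both have more edges than
  vertices, so a switching argument shows that they occur in a proportion \<open>O(1/n)\<close> of the
  connected \<open>d\<close>-regular graphs.
\<close>

section \<open>Bijections avoiding a sparse relation\<close>

text \<open>Among all bijections, one with the fewest bad points has none: a bad point could be
  repaired by exchanging two images or by rotating three, unless \<open>R\<close> contains a
  rectangle.\<close>

lemma matching_avoiding_sparse_relation: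
  assumes fin: "finite P" "finite Q" "card P = card Q"
    and row: "\<And>x. x \<in> P \<Longrightarrow> \<exists>y\<in>Q. \<not> R x y"
    and col: "\<And>y. y \<in> Q \<Longrightarrow> \<exists>x\<in>P. \<not> R x y"
    and rect: "\<And>x x' y y'. \<lbrakk>x \<in> P; x' \<in> P; y \<in> Q; y' \<in> Q; x \<noteq> x'; y \<noteq> y';
                  R x y; R x y'; R x' y; R x' y'\<rbrakk> \<Longrightarrow> False"
  shows "\<exists>\<sigma>. bij_betw \<sigma> P Q \<and> (\<forall>x\<in>P. \<not> R x (\<sigma> x))"
proof -
  define bad where "bad \<sigma> = {x \<in> P. R x (\<sigma> x)}" for \<sigma>
  obtain \<sigma>0 where "bij_betw \<sigma>0 P Q"
    using finite_same_card_bij[OF fin] by blast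
  from ex_has_least_nat[of "\<lambda>\<sigma>. bij_betw \<sigma> P Q" \<sigma>0 "\<lambda>\<sigma>. card (bad \<sigma>)", OF this]
  obtain \<sigma> where \<sigma>: "bij_betw \<sigma> P Q"
    and least: "\<And>\<tau>. bij_betw \<tau> P Q \<Longrightarrow> card (bad \<sigma>) \<le> card (bad \<tau>)"
    by blast
  \<comment> \<open>Precomposing \<open>\<sigma>\<close> with a permutation that repairs
    \<open>x\<close> and spoils no good point would contradict minimality.\<close>
  have no_improvement: False
    if "\<pi> permutes P" "x \<in> bad \<sigma>" and "\<And>v. v \<in> P \<Longrightarrow> R v (\<sigma> (\<pi> v)) \<Longrightarrow> v \<noteq> x \<and> R v (\<sigma> v)"
    for \<pi> x
  proof -
    have "bij_betw (\<sigma> \<circ> \<pi>) P Q"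
      using \<sigma> permutes_imp_bij[OF that(1)] by (rule bij_betw_trans[rotated])
    moreover have "bad (\<sigma> \<circ> \<pi>) \<subset> bad \<sigma>"
      using that(2,3) by (auto simp: bad_def)
    then have "card (bad (\<sigma> \<circ> \<pi>)) < card (bad \<sigma>)"
      by (rule psubset_card_mono[rotated]) (simp add: bad_def fin)
    ultimately show False
      using least[of "\<sigma> \<circ> \<pi>"] by simp
  qed
  have "\<not> R x (\<sigma> x)" if x: "x \<in> P" for x
  proof
    assume Rx: "R x (\<sigma> x)"
    then have xb: "x \<in> bad \<sigma>" using x by (simp add: bad_def)
    have \<sigma>P: "\<sigma> v \<in> Q" if "v \<in> P" for v using \<sigma> that by (auto simp: bij_betw_def)
    obtain u where u: "u \<in> P" "\<not> R x (\<sigma> u)"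
      using row[OF x] \<sigma> by (auto simp: bij_betw_def)
    obtain w where w: "w \<in> P" "\<not> R w (\<sigma> x)"
      using col[OF \<sigma>P[OF x]] by auto
    have ne: "u \<noteq> x" "w \<noteq> x" using u w Rx by auto
    \<comment> \<open>Exchanging the images of \<open>x\<close> and \<open>v\<close> makes
      \<open>x\<close> good, so by minimality it must make \<open>v\<close> bad.\<close>
    have swap: "R v (\<sigma> x)" if v: "v \<in> P" "\<not> R x (\<sigma> v)" for v
    proof (rule ccontr)
      assume nR: "\<not> R v (\<sigma> x)"
      have "Transposition.transpose x v permutes P"
        using x v by (intro permutes_swap_id)
      then show False
      proof (rule no_improvement[OF _ xb])
        show "y \<noteq> x \<and> R y (\<sigma> y)" if "R y (\<sigma> (Transposition.transpose x v y))" for y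
          using that v nR by (auto simp: Transposition.transpose_def split: if_splits)
      qed
    qed
    have Ru: "R u (\<sigma> x)" and Rw: "R x (\<sigma> w)"
      using swap u w by blast+
    have uw: "u \<noteq> w" using u Rw by blast
    have "\<sigma> w \<noteq> \<sigma> x"
      using \<sigma> x w(1) ne by (auto simp: bij_betw_def inj_on_def)
    then have nR: "\<not> R u (\<sigma> w)"
      using rect[of x u "\<sigma> x" "\<sigma> w"] x u w ne Rx Ru Rw \<sigma>P by metis
    \<comment> \<open>This 3-cycle gives \<open>x\<close> the image \<open>\<sigma> u\<close>,
      \<open>u\<close> the image \<open>\<sigma> w\<close> and \<open>w\<close> the image
      \<open>\<sigma> x\<close>. All three pairs lie outside \<open>R\<close>, the middle one
      because \<open>x\<close>, \<open>u\<close>, \<open>\<sigma> x\<close>,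
      \<open>\<sigma> w\<close> would otherwise span a rectangle.\<close>
    have "Transposition.transpose x u \<circ> Transposition.transpose u w permutes P"
      using x u w by (intro permutes_compose permutes_swap_id)
    then show False
    proof (rule no_improvement[OF _ xb])
      show "y \<noteq> x \<and> R y (\<sigma> y)"
        if "R y (\<sigma> ((Transposition.transpose x u \<circ> Transposition.transpose u w) y))" for y
        using that nR u w ne uw by (auto simp: Transposition.transpose_def split: if_splits)
    qed
  qed
  with \<sigma> show ?thesis by blast
qed

section \<open>Random walks driven by independent digits\<close>

definition noise :: "nat \<Rightarrow> (nat \<Rightarrow> nat) measure" where
  "noise d = PiM UNIV (\<lambda>_. uniform_count_measure {..<d})"

lemma space_noise: "space (noise d) = {\<omega>. \<forall>i. \<omega> i < d}"
  by (auto simp: noise_def space_PiM space_uniform_count_measure PiE_UNIV_domain)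

lemma prob_space_noise:
  assumes "d > 0"
  shows "prob_space (noise d)"
proof -
  have "prob_space (uniform_count_measure {..<d})"
    using assms by (intro prob_space_uniform_count_measure) auto
  then show ?thesis unfolding noise_def by (rule prob_space_PiM)
qed

lemma measure_noise_prefix:
  assumes c: "\<And>i. i < t \<Longrightarrow> c i < d" and d: "d > 0"
  shows "measure (noise d) {\<omega> \<in> space (noise d). \<forall>i<t. \<omega> i = c i} = (1 / real d) ^ t"
proof -
  let ?U = "uniform_count_measure {..<d}"
  interpret U: prob_space ?U
    using d by (intro prob_space_uniform_count_measure) auto
  interpret product_prob_space "\<lambda>_. ?U" UNIV by unfold_locales
  have eq: "{\<omega> \<in> space (noise d). \<forall>i<t. \<omega> i = c i} =
      prod_emb UNIV (\<lambda>_. ?U) {..<t} (\<Pi>\<^sub>E i\<in>{..<t}. {c i})"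
    by (auto simp: prod_emb_def noise_def space_PiM space_uniform_count_measure PiE_def
        extensional_def Pi_def restrict_def)
  have "measure (noise d) {\<omega> \<in> space (noise d). \<forall>i<t. \<omega> i = c i} = (\<Prod>i<t. measure ?U {c i})"
    unfolding eq unfolding noise_def
    by (rule measure_PiM_emb) (auto simp: sets_uniform_count_measure c)
  also have "\<dots> = (\<Prod>i<t. 1 / real d)"
    by (intro prod.cong refl) (auto simp: measure_uniform_count_measure c)
  finally show ?thesis by simp
qed

primrec traj :: "('s \<Rightarrow> nat \<Rightarrow> 's) \<Rightarrow> 's \<Rightarrow> (nat \<Rightarrow> nat) \<Rightarrow> nat \<Rightarrow> 's" where
  "traj f s \<omega> 0 = s"
| "traj f s \<omega> (Suc t) = f (traj f s \<omega> t) (\<omega> t)"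

text \<open>The state type may be uncountable, but each step only selects, by one of finitely many
  digits, among maps already known to be measurable.\<close>

lemma measurable_traj: "(\<lambda>\<omega>. traj f s \<omega> t) \<in> measurable (noise d) (count_space UNIV)"
proof (induction t)
  case (Suc t)
  have "(\<lambda>\<omega>. \<omega> t) \<in> measurable (noise d) (uniform_count_measure {..<d})"
    unfolding noise_def by measurable
  then have digit: "(\<lambda>\<omega>. \<omega> t) \<in> measurable (noise d) (count_space {..<d})"
    by (simp add: measurable_def sets_uniform_count_measure space_uniform_count_measure)
  have state: "(\<lambda>\<omega>. f (traj f s \<omega> t) k) \<in> measurable (noise d) (count_space UNIV)" for k
    by (rule measurable_compose[OF Suc]) simp
  have "(\<lambda>\<omega>. f (traj f s \<omega> t) (\<omega> t)) \<in> measurable (noise d) (count_space UNIV)"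
    by (rule measurable_compose_countable'[where f = "\<lambda>k \<omega>. f (traj f s \<omega> t) k" and I = "{..<d}"])
      (rule state digit countable_finite finite_lessThan)+
  then show ?case by simp
qed simp

text \<open>The hidden state may carry more than the observed walk: below it is the pair of walkers,
  observed through one projection at a time. The invariant \<open>I\<close> singles out the states
  in which the update rule is under control.\<close>

locale driven_walk =
  fixes G :: "'v pair_pre_digraph" and d :: nat and f :: "'s \<Rightarrow> nat \<Rightarrow> 's" and s\<^sub>0 :: 's
    and I :: "'s \<Rightarrow> bool"
  assumes d_pos: "d > 0"
    and init: "I s\<^sub>0"
    and step: "\<And>s k. I s \<Longrightarrow> k < d \<Longrightarrow> I (f s k)"
begin

lemma traj_invariant: "\<omega> \<in> space (noise d) \<Longrightarrow> I (traj f s\<^sub>0 \<omega> t)"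
  by (induction t) (auto simp: init step space_noise)

text \<open>
  Each step of the observed walk reveals the digit that drives it, so a history of positive
  probability is a cylinder of digits and determines the hidden state.
\<close>

lemma history_cases:
  fixes g :: "'s \<Rightarrow> 'v" and x :: "nat \<Rightarrow> 'v"
  assumes bij: "\<And>s. I s \<Longrightarrow> bij_betw (\<lambda>k. g (f s k)) {..<d} (nbhd G (g s))"
  defines "H \<equiv> \<lambda>t. {\<omega> \<in> space (noise d). \<forall>i\<le>t. g (traj f s\<^sub>0 \<omega> i) = x i}"
  obtains "H t = {}"
  | c s where "\<And>i. i < t \<Longrightarrow> c i < d" "I s" "g s = x t"
      "H t = {\<omega> \<in> space (noise d). \<forall>i<t. \<omega> i = c i}" "\<And>\<omega>. \<omega> \<in> H t \<Longrightarrow> traj f s\<^sub>0 \<omega> t = s"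
proof -
  have "H t = {} \<or> (\<exists>c s. (\<forall>i<t. c i < d) \<and> I s \<and> g s = x t \<and>
      H t = {\<omega> \<in> space (noise d). \<forall>i<t. \<omega> i = c i} \<and> (\<forall>\<omega>\<in>H t. traj f s\<^sub>0 \<omega> t = s))"
  proof (induction t)
    case 0
    show ?case
    proof (cases "g s\<^sub>0 = x 0")
      case True
      then show ?thesis
        using init by (intro disjI2 exI[of _ "\<lambda>_. 0"] exI[of _ s\<^sub>0]) (auto simp: H_def)
    next
      case False
      then show ?thesis by (auto simp: H_def)
    qed
  next
    case (Suc t)
    have HS: "H (Suc t) = {\<omega> \<in> H t. g (traj f s\<^sub>0 \<omega> (Suc t)) = x (Suc t)}"
      by (auto simp: H_def le_Suc_eq)
    show ?case
    proof (cases "H t = {}")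
      case True
      then show ?thesis by (simp add: HS)
    next
      case False
      with Suc obtain c s where c: "\<And>i. i < t \<Longrightarrow> c i < d" and s: "I s" "g s = x t"
        and H: "H t = {\<omega> \<in> space (noise d). \<forall>i<t. \<omega> i = c i}"
        and tr: "\<And>\<omega>. \<omega> \<in> H t \<Longrightarrow> traj f s\<^sub>0 \<omega> t = s"
        by blast
      show ?thesis
      proof (cases "x (Suc t) \<in> nbhd G (g s)")
        case True
        then obtain k where k: "k < d" "g (f s k) = x (Suc t)"
          unfolding bij_betw_imp_surj_on[OF bij[OF s(1)], symmetric] by (elim imageE) simp
        have uniq: "j = k" if "j < d" "g (f s j) = x (Suc t)" for j
          using bij[OF s(1)] that k by (auto simp: bij_betw_def inj_on_def)
        have "g (traj f s\<^sub>0 \<omega> (Suc t)) = x (Suc t) \<longleftrightarrow> \<omega> t = k" if "\<omega> \<in> H t" for \<omega>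
        proof -
          have "\<omega> t < d" using that by (simp add: H_def space_noise)
          then show ?thesis using uniq[of "\<omega> t"] k(2) tr[OF that] by auto
        qed
        then have Ht: "H (Suc t) = {\<omega> \<in> H t. \<omega> t = k}"
          unfolding HS by blast
        then have "H (Suc t) = {\<omega> \<in> space (noise d). \<forall>i<Suc t. \<omega> i = (c(t := k)) i}"
          by (auto simp: H less_Suc_eq)
        moreover have "\<forall>\<omega>\<in>H (Suc t). traj f s\<^sub>0 \<omega> (Suc t) = f s k"
          using Ht tr by auto
        moreover have "\<forall>i<Suc t. (c(t := k)) i < d"
          using c k by (auto simp: less_Suc_eq)
        ultimately show ?thesis
          using step[OF s(1) k(1)] k(2)
          by (intro disjI2 exI[of _ "c(t := k)"] exI[of _ "f s k"] conjI) auto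
      next
        case False
        have "g (f s j) \<noteq> x (Suc t)" if "j < d" for j
          using bij_betwE[OF bij[OF s(1)]] that False by (metis lessThan_iff)
        then have "H (Suc t) = {}"
          using tr by (auto simp: HS H space_noise)
        then show ?thesis by simp
      qed
    qed
  qed
  then show thesis
  proof (elim disjE exE conjE)
    assume "H t = {}"
    then show thesis by (rule that(1))
  next
    fix c s
    assume "\<forall>i<t. c i < d" "I s" "g s = x t"
      "H t = {\<omega> \<in> space (noise d). \<forall>i<t. \<omega> i = c i}" "\<forall>\<omega>\<in>H t. traj f s\<^sub>0 \<omega> t = s"
    then show thesis by (intro that(2)[of c s]) auto
  qed
qed

text \<open>A possible history fixes exactly \<open>t\<close> digits and with them the hidden state;
  one more observed step fixes one more digit. The conditional probability is thus a quotient of two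
  cylinder probabilities, \<open>1 / d\<close>. This is why each walker is Markov in its own history
  although it is driven by the joint state.\<close>

lemma simple_random_walk_traj:
  assumes bij: "\<And>s. I s \<Longrightarrow> bij_betw (\<lambda>k. g (f s k)) {..<d} (nbhd G (g s))"
    and verts: "\<And>s. I s \<Longrightarrow> g s \<in> pverts G"
  shows "simple_random_walk G (noise d) (\<lambda>t \<omega>. g (traj f s\<^sub>0 \<omega> t))"
  unfolding simple_random_walk_def
proof (intro conjI allI impI)
  show "prob_space (noise d)" by (rule prob_space_noise[OF d_pos])
  show "(\<lambda>\<omega>. g (traj f s\<^sub>0 \<omega> t)) \<in> measurable (noise d) (count_space (pverts G))" for t
  proof -
    have "(\<lambda>\<omega>. g (traj f s\<^sub>0 \<omega> t)) \<in> measurable (noise d) (count_space UNIV)"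
      by (rule measurable_compose[OF measurable_traj[of f s\<^sub>0 t d], where g = g]) simp
    from measurable_restrict_space2[OF _ this, of "pverts G"] show ?thesis
      by (simp add: restrict_count_space verts traj_invariant)
  qed
next
  fix t x u
  assume "u \<in> pverts G"
    and pos: "0 < \<P>(\<omega> in noise d. \<forall>i\<le>t. g (traj f s\<^sub>0 \<omega> i) = x i)"
  let ?H = "{\<omega> \<in> space (noise d). \<forall>i\<le>t. g (traj f s\<^sub>0 \<omega> i) = x i}"
  let ?H' = "{\<omega> \<in> space (noise d). g (traj f s\<^sub>0 \<omega> (Suc t)) = u \<and>
                (\<forall>i\<le>t. g (traj f s\<^sub>0 \<omega> i) = x i)}"
  show "\<P>(\<omega> in noise d. g (traj f s\<^sub>0 \<omega> (Suc t)) = u \<bar> \<forall>i\<le>t. g (traj f s\<^sub>0 \<omega> i) = x i) =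
      (if u \<in> nbhd G (x t) then 1 / real (deg G (x t)) else 0)"
    unfolding cond_prob_def
  proof (rule history_cases[where g = g and x = x and t = t, OF bij])
    assume "?H = {}"
    with pos show "measure (noise d) ?H' / measure (noise d) ?H =
        (if u \<in> nbhd G (x t) then 1 / real (deg G (x t)) else 0)"
      by simp
  next
    fix c s
    assume c: "\<And>i. i < t \<Longrightarrow> c i < d" and s: "I s" "g s = x t"
      and H: "?H = {\<omega> \<in> space (noise d). \<forall>i<t. \<omega> i = c i}"
      and tr: "\<And>\<omega>. \<omega> \<in> ?H \<Longrightarrow> traj f s\<^sub>0 \<omega> t = s"
    have deg: "deg G (x t) = d"
      using bij_betw_same_card[OF bij[OF s(1)]] s(2) by (simp add: deg_def)
    have H': "?H' = {\<omega> \<in> ?H. g (f s (\<omega> t)) = u}"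
      using tr by auto
    show "measure (noise d) ?H' / measure (noise d) ?H =
        (if u \<in> nbhd G (x t) then 1 / real (deg G (x t)) else 0)"
    proof (cases "u \<in> nbhd G (x t)")
      case True
      then obtain k where k: "k < d" "g (f s k) = u"
        unfolding s(2)[symmetric] bij_betw_imp_surj_on[OF bij[OF s(1)], symmetric]
        by (elim imageE) simp
      have val: "g (f s j) = u \<longleftrightarrow> j = k" if "j < d" for j
        using bij[OF s(1)] that k by (auto simp: bij_betw_def inj_on_def)
      have "?H' = {\<omega> \<in> space (noise d). \<forall>i<Suc t. \<omega> i = (c(t := k)) i}"
        unfolding H' H using val by (auto simp: less_Suc_eq space_noise)
      then have "measure (noise d) ?H' = (1 / real d) ^ Suc t"
        using c k d_pos by (simp only:) (intro measure_noise_prefix, auto simp: less_Suc_eq)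
      moreover have "measure (noise d) ?H = (1 / real d) ^ t"
        unfolding H using c d_pos by (intro measure_noise_prefix) auto
      ultimately show ?thesis
        using True deg d_pos by simp
    next
      case False
      have "g (f s j) \<noteq> u" if "j < d" for j
        using bij_betwE[OF bij[OF s(1)]] s(2) that False by (metis lessThan_iff)
      then have "?H' = {}"
        unfolding H' by (auto simp: space_noise)
      then show ?thesis using False by (simp only: measure_empty) simp
    qed
  qed
qed

end

section \<open>Coupling on graphs without crowded pairs\<close>

text \<open>The first alternative of the last disjunction is a diamond, the second a K_{2,3}, both
  as subgraphs that need not be induced.\<close>

definition crowded :: "'v rel \<Rightarrow> bool" where
  "crowded E \<longleftrightarrow> (\<exists>x y q q'. x \<noteq> y \<and> q \<noteq> q' \<and> (x, q) \<in> E \<and> (y, q) \<in> E \<and> (x, q') \<in> E \<and> (y, q') \<in> E \<and>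
     ((x, y) \<in> E \<or> (\<exists>p. p \<noteq> q \<and> p \<noteq> q' \<and> (x, p) \<in> E \<and> (y, p) \<in> E)))"

lemma crowdedI:
  assumes "x \<noteq> y" "q \<noteq> q'" "(x, q) \<in> E" "(y, q) \<in> E" "(x, q') \<in> E" "(y, q') \<in> E"
    and "(x, y) \<in> E \<or> p \<noteq> q \<and> p \<noteq> q' \<and> (x, p) \<in> E \<and> (y, p) \<in> E"
  shows "crowded E"
  using assms unfolding crowded_def by blast

locale regular_graph =
  fixes d :: nat and V :: "'v set" and E :: "'v rel"
  assumes finite_V: "finite V"
    and sym_E: "sym E"
    and irrefl_E: "irrefl E"
    and E_subset: "E \<subseteq> V \<times> V"
    and card_nbrs: "\<And>v. v \<in> V \<Longrightarrow> card (E `` {v}) = d"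
begin

lemma edge_sym: "(u, v) \<in> E \<Longrightarrow> (v, u) \<in> E"
  using sym_E by (rule symD)

lemma no_loop: "(v, v) \<notin> E"
  using irrefl_E by (simp add: irrefl_def)

lemma finite_E: "finite E"
  using E_subset finite_V by (meson finite_SigmaI finite_subset)

lemma finite_nbrs: "finite (E `` A)"
  using finite_E by (simp add: finite_Image)

lemma edge_verts: "(u, v) \<in> E \<Longrightarrow> u \<in> V" "(u, v) \<in> E \<Longrightarrow> v \<in> V"
  using E_subset by auto

lemma card_nbrs_le: "card (E `` {v}) \<le> d"
proof (cases "v \<in> V")
  case False
  then have "E `` {v} = {}" using edge_verts by auto
  then show ?thesis by simp
qed (simp add: card_nbrs)

text \<open>Otherwise \<open>x\<close> has too many neighbours: \<open>a\<close>, which is not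
  adjacent to \<open>b\<close>, and all neighbours of \<open>b\<close> other than \<open>x\<close>.
  If \<open>x\<close> is itself adjacent to \<open>b\<close>, this list loses \<open>x\<close> but
  gains \<open>b\<close>, so in either case it has \<open>d + 1\<close> members.\<close>

lemma close_nonneighbour:
  assumes "a \<noteq> b" "(a, b) \<notin> E" "(a, x) \<in> E" "b \<in> V"
  shows "\<exists>y \<in> E `` {b}. x \<noteq> y \<and> (x, y) \<notin> E"
proof (rule ccontr)
  assume "\<not> ?thesis"
  then have close: "x = y \<or> (x, y) \<in> E" if "(b, y) \<in> E" for y
    using that by auto
  let ?A = "E `` {b} - {x}"
  have sub: "insert a ?A \<subseteq> E `` {x}"
    using close assms edge_sym by auto
  have a: "a \<notin> E `` {b}" using assms edge_sym by auto
  have dx: "card (E `` {x}) = d" and db: "card (E `` {b}) = d"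
    using assms by (auto intro: card_nbrs edge_verts)
  show False
  proof (cases "(b, x) \<in> E")
    case True
    have "insert b (insert a ?A) \<subseteq> E `` {x}"
      using sub True edge_sym by auto
    then have "card (insert b (insert a ?A)) \<le> d"
      using card_mono[OF finite_nbrs] dx by metis
    moreover have "card (insert b (insert a ?A)) = Suc (Suc (d - 1))"
      using a True assms(1) db no_loop finite_nbrs by (simp add: card_insert_if)
    moreover have "d > 0"
      using db True finite_nbrs by (metis ImageI card_gt_0_iff empty_iff insertI1)
    ultimately show False by simp
  next
    case False
    then have "?A = E `` {b}" by auto
    then have "card (insert a ?A) = Suc d"
      using a db finite_nbrs by simp
    moreover have "card (insert a ?A) \<le> d"
      using card_mono[OF finite_nbrs sub] dx by simp
    ultimately show False by simp
  qed
qed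

text \<open>If all four relations are adjacencies, then \<open>x\<close> and \<open>x'\<close> have
  the three common neighbours \<open>y\<close>, \<open>y'\<close> and \<open>a\<close>. If some pair
  coincides, say \<open>x = y\<close>, then \<open>x\<close> and \<open>x'\<close> are adjacent and
  share \<open>a\<close> together with \<open>b\<close> (when \<open>x' = y'\<close>) or
  \<open>y'\<close>, which is a diamond.\<close>

lemma crowded_of_close_rectangle:
  assumes "a \<noteq> b" "(a, b) \<notin> E" "(a, x) \<in> E" "(a, x') \<in> E" "(b, y) \<in> E" "(b, y') \<in> E" "x \<noteq> x'" "y \<noteq> y'"
    and "x = y \<or> (x, y) \<in> E" "x = y' \<or> (x, y') \<in> E"
    and "x' = y \<or> (x', y) \<in> E" "x' = y' \<or> (x', y') \<in> E"
  shows "crowded E"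
proof -
  have *: "crowded E" if "(a, x) \<in> E" "(a, x') \<in> E" "(b, y') \<in> E" "x \<noteq> x'"
    "(x', x) \<in> E" "x = y" "(x, y') \<in> E" "(b, y) \<in> E" "x' = y' \<or> (x', y') \<in> E" for x x' y y'
  proof (cases "x' = y'")
    case True
    then show ?thesis
      using crowdedI[of x x' a b] that assms(1,2) edge_sym by metis
  next
    case False
    then show ?thesis
      using crowdedI[of x x' a y'] that assms(1,2) edge_sym by metis
  qed
  consider "x = y" | "x = y'" | "x' = y" | "x' = y'"
    | "x \<noteq> y" "x \<noteq> y'" "x' \<noteq> y" "x' \<noteq> y'" by blast
  then show ?thesis
  proof cases
    case 1 then show ?thesis using *[of x x' y' y] assms by metis
  next
    case 2 then show ?thesis using *[of x x' y y'] assms by metis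
  next
    case 3 then show ?thesis using *[of x' x y' y] assms by metis
  next
    case 4 then show ?thesis using *[of x' x y y'] assms by metis
  next
    case 5
    then show ?thesis
      using crowdedI[of x x' y y' E a] assms edge_sym no_loop by metis
  qed
qed

lemma separating_matching:
  assumes "\<not> crowded E" "a \<in> V" "b \<in> V" "a \<noteq> b" "(a, b) \<notin> E"
  shows "\<exists>\<sigma>. bij_betw \<sigma> (E `` {a}) (E `` {b}) \<and> (\<forall>x\<in>E `` {a}. x \<noteq> \<sigma> x \<and> (x, \<sigma> x) \<notin> E)"
proof -
  have "\<exists>\<sigma>. bij_betw \<sigma> (E `` {a}) (E `` {b}) \<and>
      (\<forall>x\<in>E `` {a}. \<not> (x = \<sigma> x \<or> (x, \<sigma> x) \<in> E))"
  proof (rule matching_avoiding_sparse_relation)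
    show "\<exists>y\<in>E `` {b}. \<not> (x = y \<or> (x, y) \<in> E)" if "x \<in> E `` {a}" for x
      using close_nonneighbour[of a b x] that assms by auto
    show "\<exists>x\<in>E `` {a}. \<not> (x = y \<or> (x, y) \<in> E)" if "y \<in> E `` {b}" for y
      using close_nonneighbour[of b a y] that assms edge_sym by fastforce
    show False
      if "x \<in> E `` {a}" "x' \<in> E `` {a}" "y \<in> E `` {b}" "y' \<in> E `` {b}" "x \<noteq> x'" "y \<noteq> y'"
        "x = y \<or> (x, y) \<in> E" "x = y' \<or> (x, y') \<in> E" "x' = y \<or> (x', y) \<in> E" "x' = y' \<or> (x', y') \<in> E"
      for x x' y y'
      using crowded_of_close_rectangle[of a b x x' y y'] that assms by simp
  qed (simp_all add: finite_nbrs card_nbrs assms)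
  then show ?thesis by simp
qed

end

lemma nbhd_eq_Image:
  assumes "parcs G \<subseteq> pverts G \<times> pverts G"
  shows "nbhd G v = parcs G `` {v}"
  using assms by (auto simp: nbhd_def)

lemma admits_avoidance_coupling_of_not_crowded:
  assumes G: "regular_graph d (pverts G) (parcs G)" and d: "d > 0"
    and nc: "\<not> crowded (parcs G)"
    and ab: "a\<^sub>0 \<in> pverts G" "b\<^sub>0 \<in> pverts G" "a\<^sub>0 \<noteq> b\<^sub>0" "(a\<^sub>0, b\<^sub>0) \<notin> parcs G"
  shows "admits_avoidance_coupling G"
proof -
  let ?V = "pverts G" and ?E = "parcs G"
  interpret regular_graph d ?V ?E by (rule G)
  have nb: "nbhd G v = ?E `` {v}" for v
    using E_subset by (rule nbhd_eq_Image)
  define I where "I s \<longleftrightarrow> fst s \<in> ?V \<and> snd s \<in> ?V \<and> fst s \<noteq> snd s \<and> (fst s, snd s) \<notin> ?E" for s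
  have "\<exists>e. bij_betw e {..<d} (?E `` {v})" if "v \<in> ?V" for v
    using card_nbrs[OF that] finite_nbrs ex_bij_betw_nat_finite by (metis lessThan_atLeast0)
  then obtain e where e: "\<And>v. v \<in> ?V \<Longrightarrow> bij_betw (e v) {..<d} (?E `` {v})"
    by metis
  have "\<forall>s. \<exists>\<sigma>. I s \<longrightarrow> bij_betw \<sigma> (?E `` {fst s}) (?E `` {snd s}) \<and>
      (\<forall>x\<in>?E `` {fst s}. x \<noteq> \<sigma> x \<and> (x, \<sigma> x) \<notin> ?E)"
    using separating_matching[OF nc] by (simp add: I_def)
  then obtain \<sigma> where bij: "\<And>s. I s \<Longrightarrow> bij_betw (\<sigma> s) (?E `` {fst s}) (?E `` {snd s})"
    and sep: "\<And>s x. I s \<Longrightarrow> (fst s, x) \<in> ?E \<Longrightarrow> x \<noteq> \<sigma> s x \<and> (x, \<sigma> s x) \<notin> ?E"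
    by (metis Image_singleton_iff)
  \<comment> \<open>One digit moves both walkers: \<open>A\<close> goes to its \<open>k\<close>-th
    neighbour and \<open>B\<close> to the partner of that neighbour. Each marginal step is uniform
    because \<open>e\<close> and \<open>\<sigma>\<close> are bijections.\<close>
  define f where "f s k = (e (fst s) k, \<sigma> s (e (fst s) k))" for s k
  have eE: "(fst s, e (fst s) k) \<in> ?E" if "I s" "k < d" for s k
    using bij_betwE[OF e[of "fst s"]] that by (auto simp: I_def)
  have \<sigma>E: "(snd s, \<sigma> s (e (fst s) k)) \<in> ?E" if "I s" "k < d" for s k
    using bij_betwE[OF bij[OF that(1)]] eE[OF that] by auto
  interpret driven_walk G d f "(a\<^sub>0, b\<^sub>0)" I
  proof
    show "I (f s k)" if "I s" "k < d" for s k
      using sep[OF that(1) eE[OF that]] edge_verts(2)[OF eE[OF that]] edge_verts(2)[OF \<sigma>E[OF that]]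
      by (simp add: I_def f_def)
  qed (use d ab in \<open>auto simp: I_def\<close>)
  let ?X = "\<lambda>t \<omega>. traj f (a\<^sub>0, b\<^sub>0) \<omega> t"
  have be: "bij_betw (\<lambda>k. e (fst s) k) {..<d} (?E `` {fst s})" if "I s" for s
    using e[of "fst s"] that by (auto simp: I_def)
  have "avoidance_coupling G (noise d) (\<lambda>t \<omega>. fst (?X t \<omega>)) (\<lambda>t \<omega>. snd (?X t \<omega>))"
    unfolding avoidance_coupling_def
  proof (intro conjI ballI allI)
    show "simple_random_walk G (noise d) (\<lambda>t \<omega>. fst (?X t \<omega>))"
    proof (rule simple_random_walk_traj)
      show "bij_betw (\<lambda>k. fst (f s k)) {..<d} (nbhd G (fst s))" if "I s" for s
        using be[OF that] by (simp add: f_def nb)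
    qed (auto simp: I_def)
    show "simple_random_walk G (noise d) (\<lambda>t \<omega>. snd (?X t \<omega>))"
    proof (rule simple_random_walk_traj)
      show "bij_betw (\<lambda>k. snd (f s k)) {..<d} (nbhd G (snd s))" if "I s" for s
        using bij_betw_trans[OF be[OF that] bij[OF that]] by (simp add: f_def nb comp_def)
    qed (auto simp: I_def)
    fix \<omega> t assume "\<omega> \<in> space (noise d)"
    then have "I (?X t \<omega>)" "\<omega> t < d"
      using traj_invariant by (auto simp: space_noise)
    moreover obtain a b where "?X t \<omega> = (a, b)"
      by (cases "?X t \<omega>")
    \<comment> \<open>The next position of \<open>A\<close> is a neighbour of \<open>a\<close>, and
      the invariant says that \<open>b\<close> is neither \<open>a\<close> nor a neighbour of
      \<open>a\<close>.\<close>
    ultimately show "snd (?X t \<omega>) \<notin> {fst (?X t \<omega>), fst (?X (Suc t) \<omega>)}"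
      using eE[of "(a, b)" "\<omega> t"] by (auto simp: I_def f_def)
  qed
  then show ?thesis by (rule avoidance_coupling_imp_admits)
qed

section \<open>Switchings\<close>

definition connected_regular :: "nat \<Rightarrow> 'v set \<Rightarrow> 'v rel \<Rightarrow> bool" where
  "connected_regular d V E \<longleftrightarrow> regular_graph d V E \<and> (\<forall>u\<in>V. \<forall>v\<in>V. (u, v) \<in> E\<^sup>*)"

definition switch :: "'v rel \<Rightarrow> 'v \<Rightarrow> 'v \<Rightarrow> 'v \<Rightarrow> 'v \<Rightarrow> 'v rel" where
  "switch E x q w z =
     (E - {(x, q), (q, x), (w, z), (z, w)}) \<union> {(x, w), (w, x), (q, z), (z, q)}"

locale switching = regular_graph d V E for d V and E :: "'v rel" +
  fixes x q w z :: 'v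
  assumes xq: "(x, q) \<in> E" and wz: "(w, z) \<in> E"
    and xw: "(x, w) \<notin> E" and qz: "(q, z) \<notin> E"
    and distinct: "x \<noteq> w" "x \<noteq> z" "q \<noteq> w" "q \<noteq> z"
begin

text \<open>The inverse is again a switching, with the two middle arguments exchanged: it removes
  \<open>xw\<close> and \<open>qz\<close> and restores \<open>xq\<close> and
  \<open>wz\<close>.\<close>

lemma switch_switch: "switch (switch E x q w z) x w q z = E"
proof -
  have "{(x, q), (q, x), (w, z), (z, w)} \<subseteq> E"
    using xq wz edge_sym by simp
  moreover have "{(x, w), (w, x), (q, z), (z, q)} \<inter> E = {}"
    using xw qz edge_sym by auto
  ultimately show ?thesis unfolding switch_def by blast
qed

text \<open>Each of the four vertices involved trades one neighbour for a former non-neighbour, and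
  no other vertex is affected.\<close>

lemma card_switch_nbrs: "card (switch E x q w z `` {v}) = card (E `` {v})"
proof -
  have swap: "card (insert b (E `` {v} - {a})) = card (E `` {v})"
    if "(v, a) \<in> E" "(v, b) \<notin> E" for a b
  proof -
    have "card (E `` {v}) > 0"
      using that finite_nbrs by (auto simp: card_gt_0_iff)
    then show ?thesis using that finite_nbrs by simp
  qed
  have ne: "x \<noteq> q" "w \<noteq> z" using xq wz no_loop by auto
  consider "v = x" | "v = q" | "v = w" | "v = z" | "v \<notin> {x, q, w, z}" by blast
  then show ?thesis
  proof cases
    case 1
    then have "switch E x q w z `` {v} = insert w (E `` {v} - {q})"
      using ne distinct by (auto simp: switch_def)
    then show ?thesis using swap[of q w] 1 xq wz xw qz edge_sym by metis
  next
    case 2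
    then have "switch E x q w z `` {v} = insert z (E `` {v} - {x})"
      using ne distinct by (auto simp: switch_def)
    then show ?thesis using swap[of x z] 2 xq wz xw qz edge_sym by metis
  next
    case 3
    then have "switch E x q w z `` {v} = insert x (E `` {v} - {z})"
      using ne distinct by (auto simp: switch_def)
    then show ?thesis using swap[of z x] 3 xq wz xw qz edge_sym by metis
  next
    case 4
    then have "switch E x q w z `` {v} = insert q (E `` {v} - {w})"
      using ne distinct by (auto simp: switch_def)
    then show ?thesis using swap[of w q] 4 xq wz xw qz edge_sym by metis
  next
    case 5
    then have "switch E x q w z `` {v} = E `` {v}"
      by (auto simp: switch_def)
    then show ?thesis by simp
  qed
qed

lemma regular_graph_switch: "regular_graph d V (switch E x q w z)"
proof
  show "sym (switch E x q w z)"
    using edge_sym by (auto simp: sym_def switch_def)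
  show "irrefl (switch E x q w z)"
    using no_loop distinct by (auto simp: irrefl_def switch_def)
  show "switch E x q w z \<subseteq> V \<times> V"
    using edge_verts xq wz E_subset by (auto simp: switch_def)
qed (simp_all add: finite_V card_switch_nbrs card_nbrs)

text \<open>Every old edge can be replaced by a path of the new graph. For \<open>xq\<close> this is
  the detour, which survives because it avoids the removed edges; for \<open>wz\<close> it is the
  new edge \<open>wx\<close>, the detour, and the new edge \<open>qz\<close>.\<close>

lemma connected_regular_switch:
  assumes conn: "connected_regular d V E"
    and detour: "(x, q) \<in> (E - {(x, q), (q, x), (w, z), (z, w)})\<^sup>*"
  shows "connected_regular d V (switch E x q w z)"
proof -
  let ?E' = "switch E x q w z"
  interpret E': regular_graph d V ?E' by (rule regular_graph_switch)
  have sym: "(v, u) \<in> ?E'\<^sup>*" if "(u, v) \<in> ?E'\<^sup>*" for u v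
    using that sym_rtrancl[OF E'.sym_E] by (auto dest: symD)
  have xq': "(x, q) \<in> ?E'\<^sup>*"
    using detour by (rule rtrancl_mono[THEN subsetD, rotated]) (auto simp: switch_def)
  have xw': "(x, w) \<in> ?E'" and qz': "(q, z) \<in> ?E'"
    by (auto simp: switch_def)
  have wz': "(w, z) \<in> ?E'\<^sup>*"
    using E'.edge_sym[OF xw'] xq' qz' by (meson converse_rtrancl_into_rtrancl rtrancl.simps)
  have "(u, v) \<in> ?E'\<^sup>*" if "(u, v) \<in> E" for u v
  proof (cases "(u, v) \<in> {(x, q), (q, x), (w, z), (z, w)}")
    case True
    then show ?thesis using xq' wz' sym by auto
  next
    case False
    then show ?thesis using that by (auto simp: switch_def)
  qed
  then have "E\<^sup>* \<subseteq> ?E'\<^sup>*"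
    by (intro rtrancl_subset_rtrancl) auto
  then show ?thesis
    using conn regular_graph_switch by (auto simp: connected_regular_def)
qed

end

text \<open>
  A crowded graph contains \<open>K\<^sub>2\<^sub>,\<^sub>3\<close> or a diamond. Removing the two edges from \<open>x\<close> to \<open>q\<close> and \<open>q'\<close>
  leaves a spanning tree of it, so switching them against two far away edges keeps the graph
  connected. There are about \<open>n\<^sup>2\<close> such switchings, but as the tree is recovered from one of its
  vertices up to boundedly many choices, only \<open>O(n)\<close> of them lead to a given graph.
\<close>

definition switch2_code :: "'v set \<Rightarrow> 'v rel \<Rightarrow> (('v \<times> 'v \<times> 'v \<times> 'v) \<times> 'v \<times> 'v \<times> 'v \<times> 'v) set" where
  "switch2_code V E = {((y, q, q', x), w, w', z, z'). y \<in> V \<and> (y, q) \<in> E \<and> (y, q') \<in> E \<and>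
     ((y, x) \<in> E \<or> (\<exists>p. (y, p) \<in> E \<and> (p, x) \<in> E)) \<and>
     (x, w) \<in> E \<and> (x, w') \<in> E \<and> (q, z) \<in> E \<and> (q', z') \<in> E}"

definition switch2 where
  "switch2 E = (\<lambda>((y, q, q', x), w, w', z, z'). switch (switch E x q w z) x q' w' z')"

text \<open>The second switching is undone first, each one by exchanging its middle
  arguments.\<close>

definition unswitch2 where
  "unswitch2 E = (\<lambda>((y, q, q', x), w, w', z, z'). switch (switch E x w' q' z') x w q z)"

lemma finite_card_Sigma_le:
  assumes "finite A" "card A \<le> k" "\<And>a. a \<in> A \<Longrightarrow> finite (B a) \<and> card (B a) \<le> m"
  shows "finite (Sigma A B) \<and> card (Sigma A B) \<le> k * m"
proof -
  have "card (Sigma A B) = (\<Sum>a\<in>A. card (B a))"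
    using assms by (intro card_SigmaI) auto
  also have "\<dots> \<le> card A * m"
    using assms(3) sum_bounded_above[of A "\<lambda>a. card (B a)" m] by simp
  also have "\<dots> \<le> k * m"
    using assms(2) by (rule mult_le_mono1)
  finally show ?thesis using assms by simp
qed

text \<open>Only \<open>y\<close> is free in the whole of \<open>V\<close>. From it,
  \<open>q\<close> and \<open>q'\<close> have \<open>d\<close> choices each, \<open>x\<close> has at
  most \<open>d + d * d\<close> as the end of a walk of length one or two, and each of
  \<open>w\<close>, \<open>w'\<close>, \<open>z\<close>, \<open>z'\<close> is a neighbour of a
  vertex already chosen.\<close>

lemma (in regular_graph) card_switch2_code_le:
  "finite (switch2_code V E) \<and>
    card (switch2_code V E) \<le> card V * (d ^ 7 * (d + 1))"
proof -
  have nb: "finite (E `` {v}) \<and> card (E `` {v}) \<le> d" for v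
    by (simp add: finite_nbrs card_nbrs_le)
  have nb2: "finite (E `` {v} \<union> snd ` (SIGMA p:E `` {v}. E `` {p})) \<and>
      card (E `` {v} \<union> snd ` (SIGMA p:E `` {v}. E `` {p})) \<le> d + d * d" for v
  proof -
    have S: "finite (SIGMA p:E `` {v}. E `` {p}) \<and> card (SIGMA p:E `` {v}. E `` {p}) \<le> d * d"
      using nb by (intro finite_card_Sigma_le) auto
    then have "card (snd ` (SIGMA p:E `` {v}. E `` {p})) \<le> d * d"
      using card_image_le le_trans by blast
    then show ?thesis
      using S nb[of v] card_Un_le[of "E `` {v}" "snd ` (SIGMA p:E `` {v}. E `` {p})"] by simp
  qed
  have nb4: "finite (E `` {x} \<times> E `` {x} \<times> E `` {q} \<times> E `` {q'}) \<and>
      card (E `` {x} \<times> E `` {x} \<times> E `` {q} \<times> E `` {q'}) \<le> d * (d * (d * d))" for x q q'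
    using nb by (auto simp: card_cartesian_product intro!: mult_le_mono)
  let ?T = "SIGMA y:V. E `` {y} \<times> E `` {y} \<times> (E `` {y} \<union> snd ` (SIGMA p:E `` {y}. E `` {p}))"
  let ?C = "SIGMA (y, q, q', x) : ?T. E `` {x} \<times> E `` {x} \<times> E `` {q} \<times> E `` {q'}"
  have base: "finite ?T \<and> card ?T \<le> card V * (d * (d * (d + d * d)))"
    using nb nb2 by (intro finite_card_Sigma_le) (simp_all add: finite_V card_cartesian_product mult_le_mono)
  have "finite ?C \<and> card ?C \<le> card V * (d * (d * (d + d * d))) * (d * (d * (d * d)))"
  proof (rule finite_card_Sigma_le)
    fix a show "finite (case a of (y, q, q', x) \<Rightarrow> E `` {x} \<times> E `` {x} \<times> E `` {q} \<times> E `` {q'}) \<and>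
        card (case a of (y, q, q', x) \<Rightarrow> E `` {x} \<times> E `` {x} \<times> E `` {q} \<times> E `` {q'}) \<le> d * (d * (d * d))"
      by (cases a) (simp only: prod.case nb4)
  qed (use base in auto)
  moreover have "?C = switch2_code V E"
    by (force simp: switch2_code_def)
  moreover have "card V * (d * (d * (d + d * d))) * (d * (d * (d * d))) = card V * (d ^ 7 * (d + 1))"
    by (simp add: eval_nat_numeral algebra_simps)
  ultimately show ?thesis by metis
qed

text \<open>The edges from \<open>y\<close> to \<open>q\<close> and \<open>q'\<close> and the link
  between \<open>y\<close> and \<open>x\<close> survive both switchings. They supply the detours
  that keep the graph connected, and they make the code readable in the switched graph. The distance
  conditions ensure that the edges to be inserted are absent and that the two switchings do not
  interfere.\<close>

lemma (in regular_graph) switch2_crowded: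
  assumes conn: "connected_regular d V E"
    and xy: "x \<noteq> y" and qq: "q \<noteq> q'"
    and edges: "(x, q) \<in> E" "(y, q) \<in> E" "(x, q') \<in> E" "(y, q') \<in> E"
    and link: "(x, y) \<in> E \<or> (\<exists>p. p \<noteq> q \<and> p \<noteq> q' \<and> (x, p) \<in> E \<and> (y, p) \<in> E)"
    and wz: "(w, z) \<in> E" "{w, z} \<inter> ({x, q, q'} \<union> E `` {x, q, q'}) = {}"
    and wz': "(w', z') \<in> E" "{w', z'} \<inter> ({x, q, q'} \<union> E `` {x, q, q'} \<union> {w, z}) = {}"
  defines "c \<equiv> ((y, q, q', x), w, w', z, z')"
  shows "connected_regular d V (switch2 E c)"
    and "c \<in> switch2_code V (switch2 E c)"
    and "unswitch2 (switch2 E c) c = E"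
proof -
  let ?E1 = "switch E x q w z"
  let ?E2 = "switch ?E1 x q' w' z'"
  have E2: "switch2 E c = ?E2"
    by (simp add: switch2_def c_def)
  have far: "w \<noteq> x" "w \<noteq> q" "w \<noteq> q'" "z \<noteq> x" "z \<noteq> q" "z \<noteq> q'"
      "w' \<noteq> x" "w' \<noteq> q" "w' \<noteq> q'" "z' \<noteq> x" "z' \<noteq> q" "z' \<noteq> q'"
      "w' \<noteq> w" "w' \<noteq> z" "z' \<noteq> w" "z' \<noteq> z"
    and nE: "(x, w) \<notin> E" "(x, z) \<notin> E" "(q, z) \<notin> E" "(q, w) \<notin> E" "(x, w') \<notin> E" "(q', z') \<notin> E"
    using wz(2) wz'(2) by auto
  have y: "y \<noteq> w" "y \<noteq> z" "y \<noteq> w'" "y \<noteq> z'" "y \<noteq> q" "y \<noteq> q'"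
  proof -
    have "y \<in> E `` {x, q, q'}"
      using edge_sym[OF edges(2)] by blast
    then show "y \<noteq> w" "y \<noteq> z" "y \<noteq> w'" "y \<noteq> z'"
      using wz(2) wz'(2) by auto
    show "y \<noteq> q" "y \<noteq> q'"
      using edges no_loop by auto
  qed
  have ne: "x \<noteq> q" "x \<noteq> q'"
    using edges no_loop by auto
  interpret s1: switching d V E x q w z
    using edges(1) wz(1) nE far by unfold_locales auto
  interpret E1: regular_graph d V ?E1
    by (rule s1.regular_graph_switch)
  have keep1: "(x, q') \<in> ?E1" "(w', z') \<in> ?E1" "(x, w') \<notin> ?E1" "(q', z') \<notin> ?E1"
    using edges wz'(1) nE far ne qq by (auto simp: switch_def)
  interpret s2: switching d V ?E1 x q' w' z'
    using keep1 far by unfold_locales auto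
  let ?D1 = "E - {(x, q), (q, x), (w, z), (z, w)}"
  let ?D2 = "?E1 - {(x, q'), (q', x), (w', z'), (z', w')}"
  \<comment> \<open>A single path from \<open>x\<close> to \<open>y\<close> serves both detours; the
    edge \<open>yq\<close> completes the first and \<open>yq'\<close> the second.\<close>
  have path: "(x, y) \<in> (?D1 \<inter> ?D2)\<^sup>*"
  proof (cases "(x, y) \<in> E")
    case True
    then have "(x, y) \<in> ?D1 \<inter> ?D2"
      using y far xy by (auto simp: switch_def)
    then show ?thesis by blast
  next
    case False
    then obtain p where p: "p \<noteq> q" "p \<noteq> q'" "(x, p) \<in> E" "(y, p) \<in> E"
      using link by blast
    have "(x, p) \<in> ?D1 \<inter> ?D2" "(p, y) \<in> ?D1 \<inter> ?D2"
      using p y far xy ne edge_sym[OF p(4)] by (auto simp: switch_def)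
    then show ?thesis by (meson r_into_rtrancl rtrancl_trans)
  qed
  have yq: "(y, q) \<in> ?D1" and yq': "(y, q') \<in> ?D2"
    using edges xy y by (auto simp: switch_def)
  have "(x, q) \<in> ?D1\<^sup>*"
    using path rtrancl_mono[of "?D1 \<inter> ?D2" ?D1] yq by (meson inf_le1 rtrancl.simps subsetD)
  then have "connected_regular d V ?E1"
    by (rule s1.connected_regular_switch[OF conn])
  moreover have "(x, q') \<in> ?D2\<^sup>*"
    using path rtrancl_mono[of "?D1 \<inter> ?D2" ?D2] yq' by (meson inf_le2 rtrancl.simps subsetD)
  ultimately show "connected_regular d V (switch2 E c)"
    unfolding E2 by (rule s2.connected_regular_switch)
  show "unswitch2 (switch2 E c) c = E"
    unfolding E2 by (simp add: unswitch2_def c_def s1.switch_switch s2.switch_switch)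
  have "(y, q) \<in> ?E2" "(y, q') \<in> ?E2" "(x, w) \<in> ?E2" "(x, w') \<in> ?E2" "(q, z) \<in> ?E2" "(q', z') \<in> ?E2"
    using edges y xy far qq ne by (auto simp: switch_def)
  moreover have "(y, x) \<in> ?E2 \<or> (\<exists>p. (y, p) \<in> ?E2 \<and> (p, x) \<in> ?E2)"
  proof (cases "(x, y) \<in> E")
    case True
    then have "(y, x) \<in> ?E2"
      using y far xy edge_sym[OF True] by (auto simp: switch_def)
    then show ?thesis by simp
  next
    case False
    then obtain p where p: "p \<noteq> q" "p \<noteq> q'" "(x, p) \<in> E" "(y, p) \<in> E"
      using link by blast
    have "(y, p) \<in> ?E2" "(p, x) \<in> ?E2"
      using p y far xy ne edge_sym[OF p(3)] by (auto simp: switch_def)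
    then show ?thesis by blast
  qed
  ultimately show "c \<in> switch2_code V (switch2 E c)"
    unfolding E2 using edge_verts(1)[OF edges(2)] by (simp add: switch2_code_def c_def)
qed

section \<open>The proportion of crowded graphs\<close>

text \<open>Excluding neighbours in \<open>F\<close> as well makes every edge at \<open>w\<close>
  disjoint from \<open>F\<close>, whichever second endpoint is chosen.\<close>

definition (in regular_graph) far :: "'v set \<Rightarrow> 'v set" where
  "far F = {w \<in> V. w \<notin> F \<and> E `` {w} \<inter> F = {}}"

lemma (in regular_graph) card_Image_le:
  assumes "finite F"
  shows "card (E `` F) \<le> d * card F"
proof -
  have "(\<Sum>v\<in>F. card (E `` {v})) \<le> card F * d"
    using sum_bounded_above[of F "\<lambda>v. card (E `` {v})" d] card_nbrs_le by simp
  moreover have "card (E `` F) \<le> (\<Sum>v\<in>F. card (E `` {v}))"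
    unfolding Image_eq_UN[of E F] by (rule card_UN_le[OF assms])
  ultimately show ?thesis by (simp add: mult.commute)
qed

text \<open>A vertex that is not far lies in \<open>F\<close> or is one of the at most
  \<open>d * card F\<close> neighbours of \<open>F\<close>.\<close>

lemma (in regular_graph) card_far_ge:
  assumes "finite F"
  shows "card V - (d + 1) * card F \<le> card (far F)"
proof -
  have "V \<subseteq> far F \<union> (F \<union> E `` F)"
    using edge_sym by (auto simp: far_def)
  then have "card V \<le> card (far F \<union> (F \<union> E `` F))"
    using assms finite_nbrs finite_V by (intro card_mono) (auto simp: far_def)
  also have "\<dots> \<le> card (far F) + (card F + card (E `` F))"
    using card_Un_le le_trans by (meson add_left_mono)
  also have "\<dots> \<le> card (far F) + (d + 1) * card F"
    using card_Image_le[OF assms] by simp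
  finally show ?thesis by simp
qed

lemma (in regular_graph) many_switchings:
  assumes conn: "connected_regular d V E" and d: "d > 0" and crowded: "crowded E"
  shows "\<exists>C. finite C \<and> (card V - (d + 1) * (3 * d + 5))\<^sup>2 \<le> card C \<and>
    (\<forall>c\<in>C. connected_regular d V (switch2 E c) \<and> c \<in> switch2_code V (switch2 E c) \<and>
       unswitch2 (switch2 E c) c = E)"
proof -
  from crowded obtain x y q q' where xy: "x \<noteq> y" and qq: "q \<noteq> q'"
    and edges: "(x, q) \<in> E" "(y, q) \<in> E" "(x, q') \<in> E" "(y, q') \<in> E"
    and link: "(x, y) \<in> E \<or> (\<exists>p. p \<noteq> q \<and> p \<noteq> q' \<and> (x, p) \<in> E \<and> (y, p) \<in> E)"
    unfolding crowded_def by blast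
  define F where "F = {x, q, q'} \<union> E `` {x, q, q'}"
  define m where "m = card V - (d + 1) * (3 * d + 5)"
  have fF: "finite F"
    by (simp add: F_def finite_nbrs)
  have 3: "card {x, q, q'} \<le> 3"
    by (simp add: card_insert_if)
  have cF: "card F \<le> 3 * d + 3"
  proof -
    have "card F \<le> card {x, q, q'} + card (E `` {x, q, q'})"
      unfolding F_def by (rule card_Un_le)
    also have "\<dots> \<le> 3 + d * 3"
      using 3 card_Image_le[of "{x, q, q'}"] by (meson add_mono finite.intros le_trans mult_le_mono2)
    finally show ?thesis by simp
  qed
  have "\<exists>z. (w, z) \<in> E" if "w \<in> V" for w
    using card_nbrs[OF that] d by (metis Image_singleton_iff card.empty equals0I less_numeral_extra(3))
  \<comment> \<open>Fixing one neighbour of each vertex lets the pair \<open>(w, w')\<close> alone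
    determine the code.\<close>
  then obtain nx where nx: "\<And>w. w \<in> V \<Longrightarrow> (w, nx w) \<in> E"
    by metis
  let ?W = "SIGMA w:far F. far (F \<union> {w, nx w})"
  let ?code = "\<lambda>(w, w'). ((y, q, q', x), w, w', nx w, nx w')"
  have ff: "finite (far A)" for A
    using finite_V by (simp add: far_def)
  \<comment> \<open>The bound \<open>3 * d + 5\<close> allows for \<open>F\<close> together with the
    edge from \<open>w\<close> to \<open>nx w\<close>, so the same \<open>m\<close> bounds the
    choices of \<open>w\<close> and those of \<open>w'\<close> from below.\<close>
  have far_ge: "m \<le> card (far A)" if "card A \<le> 3 * d + 5" "finite A" for A
    using card_far_ge[OF that(2)] mult_le_mono2[OF that(1), of "d + 1"] by (simp add: m_def)
  have "m \<le> card (far (F \<union> {w, nx w}))" for w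
  proof (rule far_ge)
    have "card (F \<union> {w, nx w}) \<le> card F + card {w, nx w}"
      by (rule card_Un_le)
    moreover have "card {w, nx w} \<le> 2"
      by (simp add: card_insert_if)
    ultimately show "card (F \<union> {w, nx w}) \<le> 3 * d + 5"
      using cF by simp
  qed (simp add: fF)
  then have "card (far F) * m \<le> (\<Sum>w\<in>far F. card (far (F \<union> {w, nx w})))"
    using sum_bounded_below[of "far F" m] by simp
  moreover have "m * m \<le> card (far F) * m"
    using cF by (intro mult_le_mono1 far_ge[OF _ fF]) simp
  moreover have "card ?W = (\<Sum>w\<in>far F. card (far (F \<union> {w, nx w})))"
    using ff by (intro card_SigmaI) auto
  moreover have "card (?code ` ?W) = card ?W"
    by (intro card_image) (auto simp: inj_on_def)
  ultimately have "m\<^sup>2 \<le> card (?code ` ?W)"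
    unfolding power2_eq_square by linarith
  moreover have "finite (?code ` ?W)"
    using ff by auto
  moreover have "connected_regular d V (switch2 E c) \<and> c \<in> switch2_code V (switch2 E c) \<and>
       unswitch2 (switch2 E c) c = E" if "c \<in> ?code ` ?W" for c
  proof -
    from that obtain w w' where w: "w \<in> far F" and w': "w' \<in> far (F \<union> {w, nx w})"
      and c: "c = ((y, q, q', x), w, w', nx w, nx w')"
      by auto
    have e: "(w, nx w) \<in> E" "{w, nx w} \<inter> ({x, q, q'} \<union> E `` {x, q, q'}) = {}"
      using w nx unfolding far_def F_def[symmetric] by auto
    have e': "(w', nx w') \<in> E"
      "{w', nx w'} \<inter> ({x, q, q'} \<union> E `` {x, q, q'} \<union> {w, nx w}) = {}"
      using w' nx unfolding far_def F_def[symmetric] by blast+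
    show ?thesis
      unfolding c by (intro conjI switch2_crowded[OF conn xy qq edges link e e'])
  qed
  ultimately show ?thesis unfolding m_def by blast
qed

text \<open>Double counting of pairs of a graph and a code. Sending \<open>(E, c)\<close> to
  \<open>(switch2 E c, c)\<close> is injective because \<open>c\<close> is kept and
  \<open>unswitch2\<close> recovers \<open>E\<close>. Each crowded graph contributes quadratically
  many pairs, while each target graph admits only linearly many codes.\<close>

lemma card_crowded_le:
  assumes V: "finite V" and d: "d > 0"
  shows "card {E. connected_regular d V E \<and> crowded E} * (card V - (d + 1) * (3 * d + 5))\<^sup>2
    \<le> card {E. connected_regular d V E} * (card V * (d ^ 7 * (d + 1)))"
proof -
  let ?A = "{E. connected_regular d V E}" and ?B = "{E. connected_regular d V E \<and> crowded E}"
  let ?K = "card V * (d ^ 7 * (d + 1))"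
  let ?m = "card V - (d + 1) * (3 * d + 5)"
  have "?A \<subseteq> Pow (V \<times> V)"
    by (auto simp: connected_regular_def dest: regular_graph.edge_verts)
  then have fA: "finite ?A"
    using V by (meson finite_Pow_iff finite_SigmaI finite_subset)
  then have fB: "finite ?B"
    by (rule rev_finite_subset) auto
  define good where "good E C \<longleftrightarrow> finite C \<and> ?m\<^sup>2 \<le> card C \<and>
    (\<forall>c\<in>C. connected_regular d V (switch2 E c) \<and> c \<in> switch2_code V (switch2 E c) \<and>
       unswitch2 (switch2 E c) c = E)" for E :: "'a rel" and C
  have "\<forall>E\<in>?B. \<exists>C. good E C"
  proof
    fix E assume E: "E \<in> ?B"
    show "\<exists>C. good E C"
      unfolding good_def
    proof (rule regular_graph.many_switchings)
      show "regular_graph d V E" "connected_regular d V E" "crowded E"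
        using E by (auto simp: connected_regular_def)
    qed (rule d)
  qed
  from bchoice[OF this] obtain C where good: "\<And>E. E \<in> ?B \<Longrightarrow> good E (C E)"
    by blast
  have C: "finite (C E)" "?m\<^sup>2 \<le> card (C E)" if "E \<in> ?B" for E
    using good[OF that] by (simp_all add: good_def)
  have switched: "connected_regular d V (switch2 E c) \<and>
      c \<in> switch2_code V (switch2 E c) \<and> unswitch2 (switch2 E c) c = E"
    if "E \<in> ?B" "c \<in> C E" for E c
    using good[OF that(1)] that(2) by (simp add: good_def)
  have codes: "finite (switch2_code V E) \<and> card (switch2_code V E) \<le> ?K" if "E \<in> ?A" for E
    using that by (intro regular_graph.card_switch2_code_le) (simp add: connected_regular_def)
  have "card ?B * ?m\<^sup>2 \<le> (\<Sum>E\<in>?B. card (C E))"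
    using sum_bounded_below[of ?B "?m\<^sup>2" "\<lambda>E. card (C E)"] C(2) by simp
  also have "\<dots> = card (Sigma ?B C)"
    using C(1) fB by (intro card_SigmaI[symmetric]) auto
  also have "\<dots> \<le> card (Sigma ?A (switch2_code V))"
  proof (rule card_inj_on_le)
    show "inj_on (\<lambda>(E, c). (switch2 E c, c)) (Sigma ?B C)"
    proof (rule inj_onI)
      fix p p' assume p: "p \<in> Sigma ?B C" "p' \<in> Sigma ?B C"
        and eq: "(case p of (E, c) \<Rightarrow> (switch2 E c, c)) = (case p' of (E, c) \<Rightarrow> (switch2 E c, c))"
      obtain E c E' c' where pair: "p = (E, c)" "p' = (E', c')"
        by (cases p, cases p')
      have "switch2 E c = switch2 E' c'" and c: "c = c'"
        using eq unfolding pair prod.case prod.inject by blast+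
      moreover have "unswitch2 (switch2 E c) c = E" "unswitch2 (switch2 E' c') c' = E'"
        using switched[of E c] switched[of E' c'] p unfolding pair by simp_all
      ultimately show "p = p'"
        unfolding pair by metis
    qed
    show "(\<lambda>(E, c). (switch2 E c, c)) ` Sigma ?B C \<subseteq> Sigma ?A (switch2_code V)"
      using switched by auto
    show "finite (Sigma ?A (switch2_code V))"
      using fA codes by auto
  qed
  also have "\<dots> \<le> card ?A * ?K"
    using finite_card_Sigma_le[OF fA order_refl codes] by simp
  finally show ?thesis .
qed

section \<open>Connected regular graphs exist\<close>

text \<open>The conditional is the difference \<open>j - i\<close> modulo \<open>n\<close>, so this
  is the circulant graph with connection set \<open>S\<close>, on the labels from 1 to
  \<open>n\<close>.\<close>

definition circulant :: "nat \<Rightarrow> nat set \<Rightarrow> nat rel" where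
  "circulant n S =
     {(i, j) \<in> {1..n} \<times> {1..n}. (if i \<le> j then j - i else j + n - i) \<in> S}"

text \<open>The neighbours of \<open>i\<close> are its translates modulo \<open>n\<close> by the
  elements of \<open>S\<close>, which are distinct. As \<open>1 \<in> S\<close>, the path 1, 2, ...,
  \<open>n\<close> connects the graph.\<close>

lemma connected_regular_circulant:
  assumes S: "S \<subseteq> {1..<n}" and sym: "\<And>s. s \<in> S \<Longrightarrow> n - s \<in> S" and one: "1 \<in> S"
  shows "connected_regular (card S) {1..n} (circulant n S)"
proof -
  have reg: "regular_graph (card S) {1..n} (circulant n S)"
  proof
    show "sym (circulant n S)"
    proof (rule symI)
      fix i j assume ij: "(i, j) \<in> circulant n S"
      have "i \<noteq> j" using ij S by (auto simp: circulant_def)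
      then show "(j, i) \<in> circulant n S"
        using ij sym[of "j - i"] sym[of "j + n - i"]
        by (auto simp: circulant_def add.commute split: if_splits)
    qed
    show "irrefl (circulant n S)"
      using S by (auto simp: circulant_def irrefl_def)
    fix i assume i: "i \<in> {1..n}"
    let ?f = "\<lambda>s. if i + s \<le> n then i + s else i + s - n"
    have inj: "inj_on ?f S"
    proof (rule inj_onI)
      fix s s' assume "s \<in> S" "s' \<in> S" "?f s = ?f s'"
      moreover have "1 \<le> s" "s < n" "1 \<le> s'" "s' < n" using S calculation by auto
      ultimately show "s = s'" using i by (auto split: if_splits)
    qed
    have "circulant n S `` {i} = ?f ` S"
    proof (intro equalityI subsetI)
      fix j assume "j \<in> circulant n S `` {i}"
      then have j: "j \<in> {1..n}" and s: "(if i \<le> j then j - i else j + n - i) \<in> S"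
        by (auto simp: circulant_def)
      have "j = ?f (if i \<le> j then j - i else j + n - i)"
        using i j by auto
      with s show "j \<in> ?f ` S" by (rule rev_image_eqI)
    next
      fix j assume "j \<in> ?f ` S"
      then obtain s where s: "s \<in> S" "j = ?f s" by blast
      moreover have "1 \<le> s" "s < n" using S s(1) by auto
      ultimately show "j \<in> circulant n S `` {i}"
        using i by (auto simp: circulant_def)
    qed
    then show "card (circulant n S `` {i}) = card S"
      using card_image[OF inj] by simp
  qed (auto simp: circulant_def)
  then interpret regular_graph "card S" "{1..n}" "circulant n S" .
  have "(1, i) \<in> (circulant n S)\<^sup>*" if "i \<in> {1..n}" for i
  proof -
    from that have "1 \<le> i" by simp
    then show ?thesis using that
    proof (induction i rule: dec_induct)
      case (step i)
      then have "(i, Suc i) \<in> circulant n S"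
        using one by (auto simp: circulant_def)
      with step show ?case by (auto intro: rtrancl_into_rtrancl)
    qed simp
  qed
  then have "(i, j) \<in> (circulant n S)\<^sup>*" if "i \<in> {1..n}" "j \<in> {1..n}" for i j
    using that sym_rtrancl[OF sym_E] by (meson rtrancl_trans symD)
  then show ?thesis
    using reg by (simp add: connected_regular_def)
qed

text \<open>The connection set consists of the residues up to \<open>d div 2\<close>, their
  negatives and, for odd \<open>d\<close>, the residue \<open>n div 2\<close>. The bound on
  \<open>n\<close> keeps these pieces disjoint.\<close>

lemma connected_regular_exists:
  assumes d: "d \<ge> 2" and n: "n > 2 * d" and even: "even (n * d)"
  shows "\<exists>E. connected_regular d {1..n} E"
proof -
  define k where "k = d div 2"
  define S where "S = {1..k} \<union> {n - k..<n} \<union> (if odd d then {n div 2} else {})"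
  have k: "1 \<le> k" "2 * k \<le> d" using d by (simp_all add: k_def)
  have cS: "card ({1..k} \<union> {n - k..<n}) = 2 * k"
    using k n by (subst card_Un_disjoint) auto
  have "card S = d"
  proof (cases "odd d")
    case True
    have "n div 2 \<notin> {1..k} \<union> {n - k..<n}"
      using k n by auto
    then have "card S = 2 * k + 1"
      using cS True by (simp add: S_def)
    then show ?thesis using True by (simp add: k_def)
  next
    case False
    then show ?thesis using cS by (simp add: S_def k_def)
  qed
  moreover have "connected_regular (card S) {1..n} (circulant n S)"
  proof (rule connected_regular_circulant)
    show "S \<subseteq> {1..<n}" using k n by (auto simp: S_def)
    show "1 \<in> S" using k by (simp add: S_def)
    fix s assume s: "s \<in> S"
    \<comment> \<open>For odd \<open>d\<close> the parity condition makes \<open>n\<close> even, so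
      \<open>n div 2\<close> is its own negative modulo \<open>n\<close>.\<close>
    have "n - n div 2 = n div 2" if "odd d" using that even by auto
    then show "n - s \<in> S" using s k n by (auto simp: S_def split: if_splits)
  qed
  ultimately show ?thesis by auto
qed

section \<open>Random connected regular graphs\<close>

text \<open>This translates between graph records and edge relations. Positivity of \<open>n\<close>
  matters because \<open>connected\<close> requires a nonempty vertex set.\<close>

lemma connected_regular_graphs_eq:
  assumes n: "n > 0"
  shows "connected_regular_graphs d n =
    (\<lambda>E. \<lparr>pverts = {1..n}, parcs = E\<rparr>) ` {E. connected_regular d {1..n} E}"
proof -
  have iff: "G \<in> connected_regular_graphs d n \<longleftrightarrow> connected_regular d {1..n} (parcs G)"
    if V: "pverts G = {1..n}" for G
  proof -
    have pair_graph_iff: "pair_graph G \<longleftrightarrow>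
        parcs G \<subseteq> {1..n} \<times> {1..n} \<and> sym (parcs G) \<and> irrefl (parcs G)"
    proof
      assume "pair_graph G"
      then interpret pair_graph G .
      show "parcs G \<subseteq> {1..n} \<times> {1..n} \<and> sym (parcs G) \<and> irrefl (parcs G)"
        using in_arcsD1 in_arcsD2 pair_sym_arcs pair_no_loops V
        by (force simp: symmetric_def irrefl_def)
    next
      assume G: "parcs G \<subseteq> {1..n} \<times> {1..n} \<and> sym (parcs G) \<and> irrefl (parcs G)"
      then have "finite (parcs G)"
        by (meson finite_SigmaI finite_atLeastAtMost finite_subset)
      with G show "pair_graph G"
        by unfold_locales (auto simp: symmetric_def irrefl_def V)
    qed
    show ?thesis
    proof (cases "parcs G \<subseteq> {1..n} \<times> {1..n} \<and> sym (parcs G) \<and> irrefl (parcs G)")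
      case True
      \<comment> \<open>Connectedness is defined through the symmetric closure, which changes
        nothing here, and through paths restricted to the vertex set, which is no restriction for
        edges inside it.\<close>
      have mk: "parcs (mk_symmetric (with_proj G)) = parcs G"
        using True by (force simp: parcs_mk_symmetric dest: symD)
      have "(u, v) \<in> rtrancl_on {1..n} (parcs G) \<longleftrightarrow> (u, v) \<in> (parcs G)\<^sup>*"
        if "u \<in> {1..n}" "v \<in> {1..n}" for u v
      proof
        show "(u, v) \<in> rtrancl_on {1..n} (parcs G)" if "(u, v) \<in> (parcs G)\<^sup>*"
          using that \<open>u \<in> {1..n}\<close> \<open>v \<in> {1..n}\<close>
          by (rule rtrancl_consistent_rtrancl_on) (use True in auto)
      qed (rule rtrancl_on_rtranclI)
      then have conn: "Digraph_Component.connected (with_proj G) \<longleftrightarrow>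
          (\<forall>u\<in>{1..n}. \<forall>v\<in>{1..n}. (u, v) \<in> (parcs G)\<^sup>*)"
        using n by (simp add: connected_def strongly_connected_def reachable_def mk V)
      have nb: "nbhd G v = parcs G `` {v}" for v
        using True V by (intro nbhd_eq_Image) simp
      have reg: "regular_graph d {1..n} (parcs G) \<longleftrightarrow> (\<forall>v\<in>{1..n}. deg G v = d)"
        using True by (simp add: regular_graph_def deg_def nb Ball_def)
      have "pair_graph G"
        using True by (rule pair_graph_iff[THEN iffD2])
      then show ?thesis
        unfolding connected_regular_graphs_def connected_regular_def mem_Collect_eq V reg conn
        by blast
    next
      case False
      then have "\<not> pair_graph G"
        unfolding pair_graph_iff .
      moreover have "\<not> regular_graph d {1..n} (parcs G)"
        using False regular_graph.E_subset regular_graph.sym_E regular_graph.irrefl_E by metis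
      ultimately show ?thesis
        by (simp add: connected_regular_graphs_def connected_regular_def)
    qed
  qed
  show ?thesis
  proof (intro equalityI subsetI)
    fix G assume G: "G \<in> connected_regular_graphs d n"
    then have V: "pverts G = {1..n}"
      by (simp add: connected_regular_graphs_def)
    then have "G = \<lparr>pverts = {1..n}, parcs = parcs G\<rparr>"
      by (cases G) simp
    moreover have "connected_regular d {1..n} (parcs G)"
      using G iff[OF V] by simp
    ultimately show "G \<in> (\<lambda>E. \<lparr>pverts = {1..n}, parcs = E\<rparr>) ` {E. connected_regular d {1..n} E}"
      by (intro image_eqI[of _ _ "parcs G"]) simp_all
  next
    fix G assume "G \<in> (\<lambda>E. \<lparr>pverts = {1..n}, parcs = E\<rparr>) ` {E. connected_regular d {1..n} E}"
    then show "G \<in> connected_regular_graphs d n"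
      using iff[of G] by auto
  qed
qed

lemma prob_admits_ge:
  assumes d: "d \<ge> 2" and n: "n > (d + 1) * (3 * d + 5)" and even: "even (n * d)"
  shows "measure_pmf.prob (pmf_of_set (connected_regular_graphs d n))
      {G. admits_avoidance_coupling G} \<ge>
    1 - real (n * (d ^ 7 * (d + 1))) /
        (real n - real ((d + 1) * (3 * d + 5)))\<^sup>2"
proof -
  let ?K = "n * (d ^ 7 * (d + 1))" and ?C = "(d + 1) * (3 * d + 5)"
  let ?A = "{E. connected_regular d {1..n} E}"
  let ?B = "{E. connected_regular d {1..n} E \<and> crowded E}"
  let ?mk = "\<lambda>E. \<lparr>pverts = {1..n}, parcs = E\<rparr>"
  let ?R = "connected_regular_graphs d n" and ?P = "{G. admits_avoidance_coupling G}"
  have nd: "n > 2 * d" "n > d + 1"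
    using n by simp_all
  have R: "?R = ?mk ` ?A"
    using nd by (intro connected_regular_graphs_eq) simp
  have inj: "inj_on ?mk X" for X
    by (auto simp: inj_on_def)
  have fR: "finite ?R"
    by (rule finite_connected_regular_graphs)
  then have fA: "finite ?A"
    unfolding R by (rule finite_imageD[OF _ inj])
  \<comment> \<open>\<open>pmf_of_set\<close> is the uniform law only for a nonempty finite set, so
    existence of a graph is needed here.\<close>
  obtain E0 where "E0 \<in> ?A"
    using connected_regular_exists[OF d nd(1) even] by blast
  then have neR: "?R \<noteq> {}" and A0: "card ?A > 0"
    using fA by (auto simp: R card_gt_0_iff)
  have "admits_avoidance_coupling (?mk E)" if E: "E \<in> ?A - ?B" for E
  proof -
    have reg: "regular_graph d {1..n} E"
      using E by (simp add: connected_regular_def)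
    \<comment> \<open>The vertex 1 and its neighbours do not exhaust the more than
      \<open>d + 1\<close> vertices, which yields a non-adjacent starting pair.\<close>
    have "card (insert 1 (E `` {1})) \<le> Suc d"
      using regular_graph.card_nbrs[OF reg, of 1] regular_graph.finite_nbrs[OF reg] nd
      by (simp add: card_insert_if)
    then have "card (insert 1 (E `` {1})) < card {1..n}"
      using nd by simp
    then have "\<not> {1..n} \<subseteq> insert 1 (E `` {1})"
      using card_mono[of "insert 1 (E `` {1})" "{1..n}"] regular_graph.finite_nbrs[OF reg]
      by (meson finite.insertI not_le)
    then obtain b where "b \<in> {1..n}" "b \<noteq> 1" "(1, b) \<notin> E" by blast
    then show ?thesis
      using E reg d nd
      by (intro admits_avoidance_coupling_of_not_crowded[of d _ 1 b]) auto
  qed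
  then have "?mk ` (?A - ?B) \<subseteq> ?R \<inter> ?P"
    unfolding R by blast
  then have "card (?mk ` (?A - ?B)) \<le> card (?R \<inter> ?P)"
    using fR by (intro card_mono) auto
  moreover have "card (?mk ` (?A - ?B)) = card ?A - card ?B"
    using fA by (subst card_image[OF inj]) (auto intro: card_Diff_subset rev_finite_subset)
  moreover have "card ?R = card ?A"
    unfolding R by (rule card_image[OF inj])
  ultimately have RA: "card ?R = card ?A" and le: "card ?A - card ?B \<le> card (?R \<inter> ?P)"
    by simp_all
  have "1 - real (card ?B) / real (card ?A) = (real (card ?A) - real (card ?B)) / real (card ?R)"
    using A0 unfolding RA by (simp only: diff_divide_distrib) simp
  also have "\<dots> \<le> real (card (?R \<inter> ?P)) / real (card ?R)"
    using le by (intro divide_right_mono) linarith+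
  also have "\<dots> = measure_pmf.prob (pmf_of_set ?R) ?P"
    using measure_pmf_of_set[OF neR fR] by simp
  finally have "1 - real (card ?B) / real (card ?A) \<le> measure_pmf.prob (pmf_of_set ?R) ?P" .
  moreover have "real (card ?B) / real (card ?A) \<le> real ?K / (real n - real ?C)\<^sup>2"
  proof -
    have "card ?B * (n - ?C)\<^sup>2 \<le> card ?A * ?K"
      using card_crowded_le[of "{1..n}" d] d by simp
    then have "real (card ?B * (n - ?C)\<^sup>2) \<le> real (card ?A * ?K)"
      by (rule of_nat_mono)
    \<comment> \<open>As \<open>n\<close> exceeds the constant, the truncated difference of naturals
      is the real difference.\<close>
    then have bound: "real (card ?B) * (real n - real ?C)\<^sup>2 \<le> real (card ?A) * real ?K"
      using n by (simp only: of_nat_mult of_nat_power of_nat_diff[OF less_imp_le])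
    have pos: "0 < (real n - real ?C)\<^sup>2"
      using n by (simp only: zero_less_power2)
    have frac: "b / a \<le> k / m" if "b * m \<le> a * k" "0 < m" "0 < a" for a b k m :: real
      using that by (simp add: field_simps)
    show ?thesis
      by (rule frac[OF bound pos]) (use A0 in linarith)
  qed
  ultimately show ?thesis by linarith
qed

theorem corollary1p2:
  fixes d :: nat
  assumes "d \<ge> 2"
  shows "((\<lambda>n. measure_pmf.prob (pmf_of_set (connected_regular_graphs d n))
                 {G. admits_avoidance_coupling G}) \<longlongrightarrow> 1)
           (inf sequentially (principal {n. d < n \<and> even (n * d)}))"
    (is "(?p \<longlongrightarrow> 1) ?F")
proof -
  define K where "K = real (d ^ 7 * (d + 1))"
  define C where "C = real ((d + 1) * (3 * d + 5))"
  have "((\<lambda>n. 1 - real n * K / (real n - C)\<^sup>2) \<longlongrightarrow> 1) sequentially"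
    by real_asymp
  then have limit: "((\<lambda>n. 1 - real n * K / (real n - C)\<^sup>2) \<longlongrightarrow> 1) ?F"
    by (rule tendsto_mono[OF inf_le1])
  \<comment> \<open>The estimate holds only for large \<open>n\<close> of the right parity: the
    first condition holds eventually, the second is part of the filter.\<close>
  have lower: "\<forall>\<^sub>F n in ?F. 1 - real n * K / (real n - C)\<^sup>2 \<le> ?p n"
    unfolding eventually_inf_principal
    using eventually_gt_at_top[of "(d + 1) * (3 * d + 5)"]
  proof eventually_elim
    case (elim n)
    then show ?case
      using prob_admits_ge[OF assms, of n] by (simp add: K_def C_def)
  qed
  show ?thesis
    by (rule tendsto_sandwich[OF lower _ limit tendsto_const]) (simp add: measure_pmf.prob_le_1)
qed

end
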